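(* Let $\mathbf{L}$ be a complete residuated lattice. The following five graded division operations on ranked data tables (RDTs) over $\mathbf{L}$ are pairwise mutually definable: the division with range $\div$, the original graded Small Divide $\div_{\mathrm{gsdo}}$, the general graded Small Divide $\div_{\mathrm{gsd}}$, the graded Great Divide $\div_{\mathrm{ggdo}}$, and the graded Darwen's Divide $\div_{\mathrm{gddo}}$. That is, for any two operations $A$ and $B$ from this list and any relation schemes admissible for the arguments $\mathcal{D}_1,\dots,\mathcal{D}_n$ of $A$, there is an expression built from symbols for $\mathcal{D}_1,\dots,\mathcal{D}_n$ using only the base operations (listed in the context) and the operation $B$ (applied to arguments on any schemes admissible for $B$), such that for all RDTs $\mathcal{D}_1,\dots,\mathcal{D}_n$ on the given schemes, the value of this expression equals the result of $A$ applied to $\mathcal{D}_1,\dots,\mathcal{D}_n$.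
   Context: A complete residuated lattice is $\mathbf{L}=\langle L,\wedge,\vee,\otimes,\rightarrow,0,1\rangle$ where $\langle L,\wedge,\vee,0,1\rangle$ is a complete lattice with least element $0$ and greatest element $1$, $\langle L,\otimes,1\rangle$ is a commutative monoid, and $a\otimes b\le c$ iff $a\le b\rightarrow c$ for all $a,b,c\in L$. Each attribute $y$ has a non-empty type (set of values) $D_y$; a relation scheme is a finite set of attributes. $\mathrm{Tupl}(R)=\prod_{y\in R}D_y$; for $r\in\mathrm{Tupl}(R)$ and $S\subseteq R$, $r(S)\in\mathrm{Tupl}(S)$ is the restriction. Tuples $r\in\mathrm{Tupl}(R)$, $s\in\mathrm{Tupl}(S)$ are joinable, $r\between s$, if $r(R\cap S)=s(R\cap S)$; then $rs=r\cup s\in\mathrm{Tupl}(R\cup S)$. An RDT on $R$ is a map $\mathcal{D}:\mathrm{Tupl}(R)\to L$ with $\{r\mid\mathcal{D}(r)>0\}$ finite. Below, writing a scheme as a juxtaposition such as $RS$ means $R\cup S$ with $R\cap S=\emptyset$. Base operations: the constant $1_\emptyset$ (the RDT on the empty scheme with $1_\emptyset(\emptyset)=1$); intersection and union of RDTs on the same scheme, $(\mathcal{A}\cap\mathcal{B})(r)=\mathcal{A}(r)\wedge\mathcal{B}(r)$, $(\mathcal{A}\cup\mathcal{B})(r)=\mathcal{A}(r)\vee\mathcal{B}(r)$; natural join of $\mathcal{A}$ on $R$ and $\mathcal{B}$ on $S$, $(\mathcal{A}\bowtie\mathcal{B})(t)=\mathcal{A}(t(R))\otimes\mathcal{B}(t(S))$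 for $t\in\mathrm{Tupl}(R\cup S)$; projection onto $S\subseteq R$, $(\pi_S(\mathcal{A}))(s)=\bigvee\{\mathcal{A}(r)\mid r(S)=s\}$; $\nabla\mathcal{A}$ with $(\nabla\mathcal{A})(r)=1$ if $\mathcal{A}(r)>0$ and $0$ otherwise; $\Delta\mathcal{A}$ with $(\Delta\mathcal{A})(r)=1$ if $\mathcal{A}(r)=1$ and $0$ otherwise; residuum with range for RDTs on the same scheme, $(\mathcal{A}\Rightarrow^{\mathcal{C}}\mathcal{B})(r)=\mathcal{C}(r)\otimes(\mathcal{A}(r)\rightarrow\mathcal{B}(r))$. Division operations: 1. $\div$: for $\mathcal{D}_1$ on $RS$, $\mathcal{D}_2$ on $S$, $\mathcal{D}_3$ on $R$: $(\mathcal{D}_1\div^{\mathcal{D}_3}\mathcal{D}_2)(r)=\bigwedge_{s\in\mathrm{Tupl}(S)}\bigl(\mathcal{D}_3(r)\otimes(\mathcal{D}_2(s)\rightarrow\mathcal{D}_1(rs))\bigr)$. 2. $\div_{\mathrm{gsdo}}$: for $\mathcal{D}_1$ on $R$, $\mathcal{D}_2$ on $S$, $\mathcal{D}_3$ on $RS$: $(\mathcal{D}_1\div^{\mathcal{D}_3}_{\mathrm{gsdo}}\mathcal{D}_2)(r)=\mathcal{D}_1(r)\otimes\bigwedge_{s\in\mathrm{Tupl}(S)}(\mathcal{D}_2(s)\rightarrow\mathcal{D}_3(rs))$. 3. $\div_{\mathrm{gsd}}$: for $\mathcal{D}_1$ on $RT$, $\mathcal{D}_2$ on $SU$, $\mathcal{D}_3$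 on $RSV$: $(\mathcal{D}_1\div^{\mathcal{D}_3}_{\mathrm{gsd}}\mathcal{D}_2)(rt)=\mathcal{D}_1(rt)\otimes\bigwedge_{s\in\mathrm{Tupl}(S)}\bigl((\pi_S(\mathcal{D}_2))(s)\rightarrow(\pi_{RS}(\mathcal{D}_3))(rs)\bigr)$. 4. $\div_{\mathrm{ggdo}}$: for $\mathcal{D}_1$ on $R$, $\mathcal{D}_2$ on $T$, $\mathcal{D}_3$ on $RS$, $\mathcal{D}_4$ on $ST$: $(\mathcal{D}_1\div^{\mathcal{D}_3,\mathcal{D}_4}_{\mathrm{ggdo}}\mathcal{D}_2)(rt)=\mathcal{D}_1(r)\otimes\mathcal{D}_2(t)\otimes\bigwedge_{s\in\mathrm{Tupl}(S)}(\mathcal{D}_4(st)\rightarrow\mathcal{D}_3(rs))$. 5. $\div_{\mathrm{gddo}}$: for $\mathcal{D}_i$ on arbitrary schemes $R_i$ ($i=1,\dots,4$) and joinable $r_1\in\mathrm{Tupl}(R_1)$, $r_2\in\mathrm{Tupl}(R_2)$: $(\mathcal{D}_1\div^{\mathcal{D}_3,\mathcal{D}_4}_{\mathrm{gddo}}\mathcal{D}_2)(r_1r_2)=\mathcal{D}_1(r_1)\otimes\mathcal{D}_2(r_2)\otimes\bigwedge_{r_4\in\mathrm{Tupl}(R_4),\,r_1r_2\between r_4}\bigl(\mathcal{D}_4(r_4)\rightarrow\bigvee_{r_3\in\mathrm{Tupl}(R_3),\,r_1r_4\between r_3}\mathcal{D}_3(r_3)\bigr)$. *)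

theory Defs
  imports Main
begin

text \<open>
  The monoid operation of a complete residuated lattice is \<open>*\<close>; the least element is \<open>bot\<close> and the
  greatest element, which is also the monoid unit, is \<open>1\<close>.
\<close>

class complete_residuated_lattice = complete_lattice + comm_monoid_mult +
  fixes residuum :: "'a \<Rightarrow> 'a \<Rightarrow> 'a"  (infixr "\<rightarrow>\<^sub>L" 60)
  assumes one_eq_top: "1 = top"
    and adjointness: "a * b \<le> c \<longleftrightarrow> a \<le> b \<rightarrow>\<^sub>L c"

text \<open>
  A tuple on the scheme \<open>R\<close> is a partial map with domain \<open>R\<close>, so that \<open>r(S)\<close> is \<open>r |` S\<close> and the
  joining \<open>rs = r \<union> s\<close> of joinable tuples is \<open>r ++ s\<close>. The values of all attributes live in one HOL
  type \<open>'v\<close>, and \<open>D y\<close> is the set of values of the attribute \<open>y\<close>.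
\<close>

type_synonym ('y, 'v) tuple = "'y \<rightharpoonup> 'v"

definition Tupl :: "('y \<Rightarrow> 'v set) \<Rightarrow> 'y set \<Rightarrow> ('y, 'v) tuple set" where
  "Tupl D R = {r. dom r = R \<and> (\<forall>y v. r y = Some v \<longrightarrow> v \<in> D y)}"

definition joinable :: "('y, 'v) tuple \<Rightarrow> ('y, 'v) tuple \<Rightarrow> bool" where
  "joinable r s \<longleftrightarrow> r |` (dom r \<inter> dom s) = s |` (dom r \<inter> dom s)"

text \<open>
  Ranks are normalized to \<open>bot\<close> outside \<open>Tupl D R\<close>, so that equality in the type below is equality
  of ranked data tables.
\<close>

datatype ('y, 'v, 'l) rdt = RDT (scheme: "'y set") (rank: "('y, 'v) tuple \<Rightarrow> 'l")

definition is_rdt ::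
    "('y \<Rightarrow> 'v set) \<Rightarrow> 'y set \<Rightarrow> ('y, 'v, 'l::complete_residuated_lattice) rdt \<Rightarrow> bool" where
  "is_rdt D R T \<longleftrightarrow> finite R \<and> scheme T = R \<and> (\<forall>r. r \<notin> Tupl D R \<longrightarrow> rank T r = bot) \<and>
     finite {r \<in> Tupl D R. rank T r > bot}"

definition mk_rdt ::
    "('y \<Rightarrow> 'v set) \<Rightarrow> 'y set \<Rightarrow> (('y, 'v) tuple \<Rightarrow> 'l) \<Rightarrow>
      ('y, 'v, 'l::complete_residuated_lattice) rdt" where
  "mk_rdt D R f = RDT R (\<lambda>r. if r \<in> Tupl D R then f r else bot)"


subsection \<open>Base operations\<close>

context
  fixes D :: "'y \<Rightarrow> 'v set"
begin

definition rone :: "('y, 'v, 'l::complete_residuated_lattice) rdt" where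
  "rone = mk_rdt D {} (\<lambda>_. 1)"

definition rinter ::
    "('y, 'v, 'l::complete_residuated_lattice) rdt \<Rightarrow> ('y, 'v, 'l) rdt \<Rightarrow> ('y, 'v, 'l) rdt" where
  "rinter A B = mk_rdt D (scheme A) (\<lambda>r. inf (rank A r) (rank B r))"

definition runion ::
    "('y, 'v, 'l::complete_residuated_lattice) rdt \<Rightarrow> ('y, 'v, 'l) rdt \<Rightarrow> ('y, 'v, 'l) rdt" where
  "runion A B = mk_rdt D (scheme A) (\<lambda>r. sup (rank A r) (rank B r))"

definition rjoin ::
    "('y, 'v, 'l::complete_residuated_lattice) rdt \<Rightarrow> ('y, 'v, 'l) rdt \<Rightarrow> ('y, 'v, 'l) rdt" where
  "rjoin A B = mk_rdt D (scheme A \<union> scheme B)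
     (\<lambda>t. rank A (t |` scheme A) * rank B (t |` scheme B))"

definition rproj ::
    "'y set \<Rightarrow> ('y, 'v, 'l::complete_residuated_lattice) rdt \<Rightarrow> ('y, 'v, 'l) rdt" where
  "rproj S A = mk_rdt D S (\<lambda>s. SUP r \<in> {r \<in> Tupl D (scheme A). r |` S = s}. rank A r)"

definition rnabla ::
    "('y, 'v, 'l::complete_residuated_lattice) rdt \<Rightarrow> ('y, 'v, 'l) rdt" where
  "rnabla A = mk_rdt D (scheme A) (\<lambda>r. if rank A r > bot then 1 else bot)"

definition rdelta ::
    "('y, 'v, 'l::complete_residuated_lattice) rdt \<Rightarrow> ('y, 'v, 'l) rdt" where
  "rdelta A = mk_rdt D (scheme A) (\<lambda>r. if rank A r = 1 then 1 else bot)"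

text \<open>\<open>rresid C A B\<close> is the residuum of \<open>A\<close> and \<open>B\<close> with range \<open>C\<close>.\<close>

definition rresid ::
    "('y, 'v, 'l::complete_residuated_lattice) rdt \<Rightarrow> ('y, 'v, 'l) rdt \<Rightarrow> ('y, 'v, 'l) rdt \<Rightarrow>
      ('y, 'v, 'l) rdt" where
  "rresid C A B = mk_rdt D (scheme C) (\<lambda>r. rank C r * (rank A r \<rightarrow>\<^sub>L rank B r))"


subsection \<open>Division operations\<close>

text \<open>
  The scheme arguments are the blocks into which the schemes of the tables are split. A result tuple
  \<open>x\<close> on a scheme such as \<open>R \<union> T\<close> is decomposed as \<open>r = x |` R\<close> and \<open>t = x |` T\<close>.
\<close>

definition range_divide ::
    "'y set \<Rightarrow> 'y set \<Rightarrow> ('y, 'v, 'l::complete_residuated_lattice) rdt \<Rightarrow> ('y, 'v, 'l) rdt \<Rightarrow>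
      ('y, 'v, 'l) rdt \<Rightarrow> ('y, 'v, 'l) rdt" where
  "range_divide R S D1 D2 D3 = mk_rdt D R
     (\<lambda>r. INF s \<in> Tupl D S. rank D3 r * (rank D2 s \<rightarrow>\<^sub>L rank D1 (r ++ s)))"

definition gsdo_divide ::
    "'y set \<Rightarrow> 'y set \<Rightarrow> ('y, 'v, 'l::complete_residuated_lattice) rdt \<Rightarrow> ('y, 'v, 'l) rdt \<Rightarrow>
      ('y, 'v, 'l) rdt \<Rightarrow> ('y, 'v, 'l) rdt" where
  "gsdo_divide R S D1 D2 D3 = mk_rdt D R
     (\<lambda>r. rank D1 r * (INF s \<in> Tupl D S. rank D2 s \<rightarrow>\<^sub>L rank D3 (r ++ s)))"

definition gsd_divide ::
    "'y set \<Rightarrow> 'y set \<Rightarrow> 'y set \<Rightarrow> ('y, 'v, 'l::complete_residuated_lattice) rdt \<Rightarrow>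
      ('y, 'v, 'l) rdt \<Rightarrow> ('y, 'v, 'l) rdt \<Rightarrow> ('y, 'v, 'l) rdt" where
  "gsd_divide R S T D1 D2 D3 = mk_rdt D (R \<union> T)
     (\<lambda>x. rank D1 x *
       (INF s \<in> Tupl D S. rank (rproj S D2) s \<rightarrow>\<^sub>L rank (rproj (R \<union> S) D3) (x |` R ++ s)))"

definition ggdo_divide ::
    "'y set \<Rightarrow> 'y set \<Rightarrow> 'y set \<Rightarrow> ('y, 'v, 'l::complete_residuated_lattice) rdt \<Rightarrow>
      ('y, 'v, 'l) rdt \<Rightarrow> ('y, 'v, 'l) rdt \<Rightarrow> ('y, 'v, 'l) rdt \<Rightarrow> ('y, 'v, 'l) rdt" where
  "ggdo_divide R S T D1 D2 D3 D4 = mk_rdt D (R \<union> T)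
     (\<lambda>x. rank D1 (x |` R) * rank D2 (x |` T) *
       (INF s \<in> Tupl D S. rank D4 (s ++ x |` T) \<rightarrow>\<^sub>L rank D3 (x |` R ++ s)))"

definition gddo_divide ::
    "'y set \<Rightarrow> 'y set \<Rightarrow> 'y set \<Rightarrow> 'y set \<Rightarrow> ('y, 'v, 'l::complete_residuated_lattice) rdt \<Rightarrow>
      ('y, 'v, 'l) rdt \<Rightarrow> ('y, 'v, 'l) rdt \<Rightarrow> ('y, 'v, 'l) rdt \<Rightarrow> ('y, 'v, 'l) rdt" where
  "gddo_divide R1 R2 R3 R4 D1 D2 D3 D4 = mk_rdt D (R1 \<union> R2)
     (\<lambda>x. rank D1 (x |` R1) * rank D2 (x |` R2) *
       (INF r4 \<in> {r4 \<in> Tupl D R4. joinable x r4}.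
          rank D4 r4 \<rightarrow>\<^sub>L
            (SUP r3 \<in> {r3 \<in> Tupl D R3. joinable (x |` R1 ++ r4) r3}. rank D3 r3)))"

end

datatype division = Div | Gsdo | Gsd | Ggdo | Gddo

text \<open>
  An instance of a division operation is the operation together with the blocks determining the
  schemes of its arguments. Blocks written in juxtaposition are required to be disjoint.
\<close>

datatype 'y divop =
    DivOp "'y set" "'y set"
  | GsdoOp "'y set" "'y set"
  | GsdOp "'y set" "'y set" "'y set" "'y set" "'y set"
  | GgdoOp "'y set" "'y set" "'y set"
  | GddoOp "'y set" "'y set" "'y set" "'y set"

fun kind :: "'y divop \<Rightarrow> division" where
  "kind (DivOp R S) = Div"
| "kind (GsdoOp R S) = Gsdo"
| "kind (GsdOp R S T U V) = Gsd"
| "kind (GgdoOp R S T) = Ggdo"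
| "kind (GddoOp R1 R2 R3 R4) = Gddo"

fun arg_schemes :: "'y divop \<Rightarrow> 'y set list" where
  "arg_schemes (DivOp R S) = [R \<union> S, S, R]"
| "arg_schemes (GsdoOp R S) = [R, S, R \<union> S]"
| "arg_schemes (GsdOp R S T U V) = [R \<union> T, S \<union> U, R \<union> S \<union> V]"
| "arg_schemes (GgdoOp R S T) = [R, T, R \<union> S, S \<union> T]"
| "arg_schemes (GddoOp R1 R2 R3 R4) = [R1, R2, R3, R4]"

fun res_scheme :: "'y divop \<Rightarrow> 'y set" where
  "res_scheme (DivOp R S) = R"
| "res_scheme (GsdoOp R S) = R"
| "res_scheme (GsdOp R S T U V) = R \<union> T"
| "res_scheme (GgdoOp R S T) = R \<union> T"
| "res_scheme (GddoOp R1 R2 R3 R4) = R1 \<union> R2"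

fun disjoint_blocks :: "'y divop \<Rightarrow> bool" where
  "disjoint_blocks (DivOp R S) \<longleftrightarrow> R \<inter> S = {}"
| "disjoint_blocks (GsdoOp R S) \<longleftrightarrow> R \<inter> S = {}"
| "disjoint_blocks (GsdOp R S T U V) \<longleftrightarrow>
     R \<inter> T = {} \<and> S \<inter> U = {} \<and> R \<inter> S = {} \<and> R \<inter> V = {} \<and> S \<inter> V = {}"
| "disjoint_blocks (GgdoOp R S T) \<longleftrightarrow> R \<inter> S = {} \<and> S \<inter> T = {} \<and> R \<inter> T = {}"
| "disjoint_blocks (GddoOp R1 R2 R3 R4) \<longleftrightarrow> True"

definition admissible :: "'y divop \<Rightarrow> bool" where
  "admissible a \<longleftrightarrow> disjoint_blocks a \<and> (\<forall>R \<in> set (arg_schemes a). finite R)"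

fun div_apply ::
    "('y \<Rightarrow> 'v set) \<Rightarrow> 'y divop \<Rightarrow> ('y, 'v, 'l::complete_residuated_lattice) rdt list \<Rightarrow>
      ('y, 'v, 'l) rdt" where
  "div_apply D (DivOp R S) [D1, D2, D3] = range_divide D R S D1 D2 D3"
| "div_apply D (GsdoOp R S) [D1, D2, D3] = gsdo_divide D R S D1 D2 D3"
| "div_apply D (GsdOp R S T U V) [D1, D2, D3] = gsd_divide D R S T D1 D2 D3"
| "div_apply D (GgdoOp R S T) [D1, D2, D3, D4] = ggdo_divide D R S T D1 D2 D3 D4"
| "div_apply D (GddoOp R1 R2 R3 R4) [D1, D2, D3, D4] = gddo_divide D R1 R2 R3 R4 D1 D2 D3 D4"


subsection \<open>Expressions\<close>

text \<open>\<open>Sym i\<close> is the symbol for the \<open>i\<close>-th argument table, counted from \<open>0\<close>.\<close>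

datatype 'y expr =
    Sym nat
  | One
  | Intersect "'y expr" "'y expr"
  | Unite "'y expr" "'y expr"
  | Join "'y expr" "'y expr"
  | Proj "'y set" "'y expr"
  | Nabla "'y expr"
  | Delta "'y expr"
  | Resid "'y expr" "'y expr" "'y expr"
  | Divide "'y divop" "'y expr list"

text \<open>
  \<open>expr_on Rs e R\<close>: if the \<open>i\<close>-th symbol stands for a table on \<open>Rs ! i\<close>, then \<open>e\<close> is a well-formed
  expression denoting a table on \<open>R\<close>.
\<close>

inductive expr_on :: "'y set list \<Rightarrow> 'y expr \<Rightarrow> 'y set \<Rightarrow> bool" for Rs where
  "i < length Rs \<Longrightarrow> expr_on Rs (Sym i) (Rs ! i)"
| "expr_on Rs One {}"
| "expr_on Rs e R \<Longrightarrow> expr_on Rs f R \<Longrightarrow> expr_on Rs (Intersect e f) R"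
| "expr_on Rs e R \<Longrightarrow> expr_on Rs f R \<Longrightarrow> expr_on Rs (Unite e f) R"
| "expr_on Rs e R \<Longrightarrow> expr_on Rs f S \<Longrightarrow> expr_on Rs (Join e f) (R \<union> S)"
| "expr_on Rs e R \<Longrightarrow> S \<subseteq> R \<Longrightarrow> expr_on Rs (Proj S e) S"
| "expr_on Rs e R \<Longrightarrow> expr_on Rs (Nabla e) R"
| "expr_on Rs e R \<Longrightarrow> expr_on Rs (Delta e) R"
| "expr_on Rs g R \<Longrightarrow> expr_on Rs e R \<Longrightarrow> expr_on Rs f R \<Longrightarrow> expr_on Rs (Resid g e f) R"
| "admissible b \<Longrightarrow> list_all2 (expr_on Rs) es (arg_schemes b) \<Longrightarrow>
     expr_on Rs (Divide b es) (res_scheme b)"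

fun divisions :: "'y expr \<Rightarrow> division set" where
  "divisions (Sym i) = {}"
| "divisions One = {}"
| "divisions (Intersect e f) = divisions e \<union> divisions f"
| "divisions (Unite e f) = divisions e \<union> divisions f"
| "divisions (Join e f) = divisions e \<union> divisions f"
| "divisions (Proj S e) = divisions e"
| "divisions (Nabla e) = divisions e"
| "divisions (Delta e) = divisions e"
| "divisions (Resid g e f) = divisions g \<union> divisions e \<union> divisions f"
| "divisions (Divide b es) = insert (kind b) (\<Union>e \<in> set es. divisions e)"

fun eval ::
    "('y \<Rightarrow> 'v set) \<Rightarrow> ('y, 'v, 'l::complete_residuated_lattice) rdt list \<Rightarrow> 'y expr \<Rightarrow>
      ('y, 'v, 'l) rdt" where
  "eval D Ts (Sym i) = Ts ! i"
| "eval D Ts One = rone D"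
| "eval D Ts (Intersect e f) = rinter D (eval D Ts e) (eval D Ts f)"
| "eval D Ts (Unite e f) = runion D (eval D Ts e) (eval D Ts f)"
| "eval D Ts (Join e f) = rjoin D (eval D Ts e) (eval D Ts f)"
| "eval D Ts (Proj S e) = rproj D S (eval D Ts e)"
| "eval D Ts (Nabla e) = rnabla D (eval D Ts e)"
| "eval D Ts (Delta e) = rdelta D (eval D Ts e)"
| "eval D Ts (Resid g e f) = rresid D (eval D Ts g) (eval D Ts e) (eval D Ts f)"
| "eval D Ts (Divide b es) = div_apply D b (map (eval D Ts) es)"

end

theory Submission imports Defs begin

text \<open>
  All five operations are reduced to the original Small Divide \<open>gsdo\<close>. In one direction, \<open>gsdo\<close> is
  an instance of each operation, except that \<open>\<div>\<close> multiplies by the range under the infimum: there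
  one divides with the crisp range \<open>\<nabla>\<D>\<^sub>1\<close> and joins with \<open>\<D>\<^sub>1\<close> afterwards. In the other direction,
  since the divisor has finite support, the infimum may be restricted to its support; the residuum
  with range then forms the table of all the terms of the infimum, and a \<open>gsdo\<close> with crisp dividend
  and divisor computes the infimum itself.
\<close>

section \<open>Residuated lattices and tuples\<close>

lemma mult_bot_left [simp]: "bot * a = (bot :: 'a :: complete_residuated_lattice)"
  by (meson adjointness bot.extremum bot.extremum_unique)

lemma mult_bot_right [simp]: "a * bot = (bot :: 'a :: complete_residuated_lattice)"
  by (metis mult.commute mult_bot_left)

text \<open>Through this the tuples outside the support of a divisor contribute only the neutral
  term \<open>1\<close> to an infimum.\<close>

lemma residuum_bot [simp]: "bot \<rightarrow>\<^sub>L a = (1 :: 'a :: complete_residuated_lattice)"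
  by (metis adjointness bot.extremum mult_bot_right one_eq_top top.extremum_uniqueI)

lemma residuum_one [simp]: "1 \<rightarrow>\<^sub>L a = (a :: 'a :: complete_residuated_lattice)"
  by (metis adjointness dual_order.refl mult.right_neutral order_antisym)

lemma le_one [simp]: "a \<le> (1 :: 'a :: complete_residuated_lattice)"
  by (simp add: one_eq_top)

text \<open>Integrality: the unit is the top, so \<open>b\<close> lies below \<open>1\<close>, which
  in turn lies below the residuum of \<open>a\<close> with itself; adjointness does the
  rest.\<close>

lemma mult_le_left: "a * b \<le> (a :: 'a :: complete_residuated_lattice)"
proof -
  have "b \<le> a \<rightarrow>\<^sub>L a"
    by (metis adjointness le_one mult.left_neutral order_refl order_trans)
  then show ?thesis
    by (metis adjointness mult.commute)
qed

lemma not_bot_less [simp]: "\<not> bot < a \<longleftrightarrow> a = (bot :: 'a :: complete_residuated_lattice)"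
  using bot.not_eq_extremum by blast

section \<open>Restriction, joining and joinability of tuples\<close>

lemma restrict_in_Tupl [simp]: "r \<in> Tupl D Q \<Longrightarrow> R \<subseteq> Q \<Longrightarrow> r |` R \<in> Tupl D R"
  by (auto simp: Tupl_def restrict_map_def split: if_splits)

lemma dom_Tupl: "r \<in> Tupl D R \<Longrightarrow> dom r = R"
  by (simp add: Tupl_def)

lemma restrict_Tupl_self:
  assumes "r \<in> Tupl D R" "R \<subseteq> Q"
  shows "r |` Q = r"
proof
  fix y
  show "(r |` Q) y = r y"
    using dom_Tupl[OF assms(1)] assms(2) by (cases "r y") (auto simp: restrict_map_def)
qed

lemma map_add_in_Tupl [simp]: "r \<in> Tupl D R \<Longrightarrow> s \<in> Tupl D S \<Longrightarrow> r ++ s \<in> Tupl D (R \<union> S)"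
  by (auto simp: Tupl_def map_add_def split: option.splits)

lemma restrict_map_add_left:
  "r \<in> Tupl D R \<Longrightarrow> s \<in> Tupl D S \<Longrightarrow> Q \<inter> S = {} \<Longrightarrow> (r ++ s) |` Q = r |` Q"
  by (rule ext) (auto simp: Tupl_def restrict_map_def map_add_def dom_def split: option.splits)

lemma restrict_map_add_right:
  "s \<in> Tupl D S \<Longrightarrow> Q \<subseteq> S \<Longrightarrow> (r ++ s) |` Q = s |` Q"
  by (rule ext) (auto simp: Tupl_def restrict_map_def map_add_def dom_def split: option.splits)

lemma Tupl_empty [simp]: "Tupl D {} = {Map.empty}"
  by (auto simp: Tupl_def)

text \<open>Keeps infima over \<open>Tupl D S\<close> from being empty, so that a constant can be
  moved into or out of them.\<close>

lemma Tupl_nonempty: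
  assumes "\<And>y. D y \<noteq> {}"
  shows "Tupl D R \<noteq> {}"
proof -
  have "(\<lambda>y. if y \<in> R then Some (SOME v. v \<in> D y) else None) \<in> Tupl D R"
    using assms by (auto simp: Tupl_def some_in_eq split: if_splits)
  then show ?thesis by blast
qed

lemma joinable_iff: "joinable r s \<longleftrightarrow> (\<forall>y \<in> dom r \<inter> dom s. r y = s y)"
  by (auto simp: joinable_def restrict_map_def fun_eq_iff)

section \<open>Schemes and ranks of tables built by the operations\<close>

lemma scheme_mk_rdt [simp]: "scheme (mk_rdt D R f) = R"
  by (simp add: mk_rdt_def)

lemma rank_mk_rdt [simp]: "r \<in> Tupl D R \<Longrightarrow> rank (mk_rdt D R f) r = f r"
  by (simp add: mk_rdt_def)

lemma mk_rdt_cong: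
  "R = S \<Longrightarrow> (\<And>r. r \<in> Tupl D S \<Longrightarrow> f r = g r) \<Longrightarrow> mk_rdt D R f = mk_rdt D S g"
  by (auto simp: mk_rdt_def fun_eq_iff)

lemma scheme_base [simp]:
  "scheme (rone D) = {}"
  "scheme (rinter D A B) = scheme A"
  "scheme (rjoin D A B) = scheme A \<union> scheme B"
  "scheme (rproj D S A) = S"
  "scheme (rnabla D A) = scheme A"
  "scheme (rresid D C A B) = scheme C"
  by (simp_all add: rone_def rinter_def rjoin_def rproj_def rnabla_def rresid_def)

text \<open>The fibre of a projection onto the whole scheme is a single tuple. This makes the
  projections inside \<open>gsd_divide\<close> disappear when the extra blocks are empty.\<close>

lemma rank_rproj_self [simp]:
  assumes "s \<in> Tupl D (scheme A)" "S = scheme A"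
  shows "rank (rproj D S A) s = rank A s"
proof -
  have "{r \<in> Tupl D (scheme A). r |` S = s} = {s}"
    using assms by (auto simp: restrict_Tupl_self)
  then show ?thesis using assms by (simp add: rproj_def)
qed

text \<open>Used to transfer supports: a tuple of nonzero rank restricts to one of nonzero rank in
  the projection, and where the projection vanishes so does the table.\<close>

lemma rank_le_rproj:
  assumes "r \<in> Tupl D (scheme A)" "S \<subseteq> scheme A"
  shows "rank A r \<le> rank (rproj D S A) (r |` S)"
  using assms by (auto simp: rproj_def intro!: SUP_upper)

lemma scheme_div_apply [simp]:
  "length Ts = length (arg_schemes b) \<Longrightarrow> scheme (div_apply D b Ts) = res_scheme b"
  by (cases b) (auto simp: length_Suc_conv range_divide_def gsdo_divide_def gsd_divide_def
      ggdo_divide_def gddo_divide_def numeral_eq_Suc)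


section \<open>Identities between the divisions\<close>

text \<open>Multiplication need not distribute over infima, so \<open>D1\<close> itself cannot serve
  as the range. Its crisp support contributes only a factor \<open>1\<close> under the infimum, and
  the join supplies the real factor afterwards.\<close>

lemma gsdo_eq_range:
  assumes [simp]: "scheme D1 = R"
  shows "gsdo_divide D R S D1 D2 D3 = rjoin D D1 (range_divide D R S D3 D2 (rnabla D D1))"
  unfolding gsdo_divide_def rjoin_def
proof (intro mk_rdt_cong)
  let ?Q = "range_divide D R S D3 D2 (rnabla D D1)"
  have [simp]: "scheme ?Q = R" by (simp add: range_divide_def)
  show "R = scheme D1 \<union> scheme ?Q" by simp
  fix r assume "r \<in> Tupl D (scheme D1 \<union> scheme ?Q)"
  then have r: "r \<in> Tupl D R" by simp
  show "rank D1 r * (INF s \<in> Tupl D S. rank D2 s \<rightarrow>\<^sub>L rank D3 (r ++ s)) =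
      rank D1 (r |` scheme D1) * rank ?Q (r |` scheme ?Q)"
    \<comment> \<open>On the support of \<open>D1\<close> the range has rank \<open>1\<close>; off
      it the outer factor makes both sides \<open>bot\<close>.\<close>
    using r by (cases "bot < rank D1 r")
      (simp_all add: restrict_Tupl_self range_divide_def rnabla_def)
qed

text \<open>With the additional blocks empty, both projections in \<open>gsd_divide\<close> are onto
  full schemes and hence trivial.\<close>

lemma gsdo_eq_gsd:
  assumes "scheme D1 = R" "scheme D2 = S" "scheme D3 = R \<union> S"
  shows "gsdo_divide D R S D1 D2 D3 = gsd_divide D R S {} D1 D2 D3"
  using assms unfolding gsdo_divide_def gsd_divide_def
  by (intro mk_rdt_cong) (auto simp: restrict_Tupl_self)

text \<open>An empty block \<open>T\<close> leaves only the empty tuple, to which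
  \<open>rone\<close> gives rank \<open>1\<close>, so the second dividend is a neutral
  factor.\<close>

lemma gsdo_eq_ggdo:
  "gsdo_divide D R S D1 D2 D3 = ggdo_divide D R S {} D1 (rone D) D3 D2"
  unfolding gsdo_divide_def ggdo_divide_def
  by (intro mk_rdt_cong) (auto simp: restrict_Tupl_self rone_def)

text \<open>For disjoint blocks the joinability conditions leave only the \<open>S\<close>-part of
  the divisor tuple free, and then determine the tuple under the supremum uniquely.\<close>

lemma ggdo_eq_gddo:
  assumes "R \<inter> S = {}" "S \<inter> T = {}" "R \<inter> T = {}"
  shows "ggdo_divide D R S T D1 D2 D3 D4 = gddo_divide D R T (R \<union> S) (S \<union> T) D1 D2 D3 D4"
  unfolding ggdo_divide_def gddo_divide_def
proof (intro mk_rdt_cong refl)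
  fix x assume x: "x \<in> Tupl D (R \<union> T)"
  have R: "x |` R \<in> Tupl D R" and T: "x |` T \<in> Tupl D T"
    using x by auto
  \<comment> \<open>The values on \<open>T\<close> are dictated by \<open>x\<close>, while
    \<open>S\<close> does not meet the scheme of \<open>x\<close>; this reindexes the infimum by
    \<open>Tupl D S\<close>.\<close>
  have r4: "{r4 \<in> Tupl D (S \<union> T). joinable x r4} = (\<lambda>s. s ++ x |` T) ` Tupl D S"
  proof (intro equalityI subsetI)
    fix r4 assume "r4 \<in> {r4 \<in> Tupl D (S \<union> T). joinable x r4}"
    then have r4: "r4 \<in> Tupl D (S \<union> T)" "joinable x r4" by auto
    note d = dom_Tupl[OF x] dom_Tupl[OF r4(1)]
    have "r4 = r4 |` S ++ x |` T"
    proof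
      fix y
      show "r4 y = (r4 |` S ++ x |` T) y"
      proof (cases "y \<in> T")
        case True
        then have "x y = r4 y" "x y \<noteq> None" using d r4 by (auto simp: joinable_iff)
        then show ?thesis using True by (auto simp: map_add_def)
      next
        case False
        then have "y \<in> S \<or> r4 y = None" using d by blast
        then show ?thesis using False by (auto simp: map_add_def restrict_map_def)
      qed
    qed
    moreover have "r4 |` S \<in> Tupl D S" using r4 by auto
    ultimately show "r4 \<in> (\<lambda>s. s ++ x |` T) ` Tupl D S" by blast
  next
    fix r4 assume "r4 \<in> (\<lambda>s. s ++ x |` T) ` Tupl D S"
    then obtain s where s: "s \<in> Tupl D S" "r4 = s ++ x |` T" by blast
    have "joinable x (s ++ x |` T)"
      unfolding joinable_iff
    proof
      fix y assume "y \<in> dom x \<inter> dom (s ++ x |` T)"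
      then have "y \<in> T"
        using dom_Tupl[OF x] dom_Tupl[OF s(1)] assms by auto
      then show "x y = (s ++ x |` T) y"
        using dom_Tupl[OF x] by (auto simp: map_add_def split: option.splits)
    qed
    then show "r4 \<in> {r4 \<in> Tupl D (S \<union> T). joinable x r4}"
      using s T by simp
  qed
  \<comment> \<open>Every attribute of \<open>r3\<close> is already fixed by joinability, so the
    supremum is over a singleton.\<close>
  have r3: "{r3 \<in> Tupl D (R \<union> S). joinable (x |` R ++ (s ++ x |` T)) r3} = {x |` R ++ s}"
    if s: "s \<in> Tupl D S" for s
  proof -
    have "r3 = x |` R ++ s \<longleftrightarrow> joinable (x |` R ++ (s ++ x |` T)) r3"
      if r3: "r3 \<in> Tupl D (R \<union> S)" for r3
    proof -
      let ?w = "x |` R ++ (s ++ x |` T)"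
      have w: "?w |` (R \<union> S) = x |` R ++ s"
      proof -
        have "?w = (x |` R ++ s) ++ x |` T" by simp
        then show ?thesis
          using restrict_map_add_left[OF map_add_in_Tupl[OF R s] T, of "R \<union> S"] assms
            restrict_Tupl_self[OF map_add_in_Tupl[OF R s] order_refl] by auto
      qed
      have "dom ?w \<inter> dom r3 = R \<union> S"
        using dom_Tupl[OF r3] dom_Tupl[OF R] dom_Tupl[OF s] by auto
      then show ?thesis
        unfolding joinable_def using w restrict_Tupl_self[OF r3 order_refl] by metis
    qed
    with map_add_in_Tupl[OF R s] show ?thesis by blast
  qed
  show "rank D1 (x |` R) * rank D2 (x |` T) *
      (INF s \<in> Tupl D S. rank D4 (s ++ x |` T) \<rightarrow>\<^sub>L rank D3 (x |` R ++ s)) =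
    rank D1 (x |` R) * rank D2 (x |` T) *
      (INF r4 \<in> {r4 \<in> Tupl D (S \<union> T). joinable x r4}. rank D4 r4 \<rightarrow>\<^sub>L
        (SUP r3 \<in> {r3 \<in> Tupl D (R \<union> S). joinable (x |` R ++ r4) r3}. rank D3 r3))"
    unfolding r4 image_image
    by (intro arg_cong[where f = "(*) _"] INF_cong refl) (subst r3, assumption, simp)
qed

text \<open>Where \<open>D3\<close> is nonzero, \<open>rresid\<close> tabulates the terms of the
  infimum for \<open>s\<close> in the support of \<open>D2\<close>; dividing by the crisp
  \<open>rnabla D D2\<close> takes their infimum and puts \<open>1\<close> elsewhere. The missing
  terms all equal the rank in \<open>D3\<close>, which the final intersection restores.\<close>

lemma range_eq_gsdo:
  assumes "\<And>y. D y \<noteq> {}" and "R \<inter> S = {}"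
    and [simp]: "scheme D1 = R \<union> S" "scheme D2 = S" "scheme D3 = R"
  shows "range_divide D R S D1 D2 D3 =
    rinter D D3 (gsdo_divide D R S (rnabla D D3) (rnabla D D2)
      (rresid D (rjoin D D3 (rnabla D D2)) (rjoin D (rnabla D D3) D2) D1))"
  unfolding range_divide_def rinter_def
proof (intro mk_rdt_cong)
  fix r assume r: "r \<in> Tupl D (scheme D3)"
  then have r': "r \<in> Tupl D R" by simp
  let ?G = "gsdo_divide D R S (rnabla D D3) (rnabla D D2)
    (rresid D (rjoin D D3 (rnabla D D2)) (rjoin D (rnabla D D3) D2) D1)"
  let ?t = "\<lambda>s. rank D3 r * (rank D2 s \<rightarrow>\<^sub>L rank D1 (r ++ s))"
  \<comment> \<open>The terms as the crisp division sees them, with default \<open>1\<close> off the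
    support of \<open>D2\<close>.\<close>
  let ?u = "\<lambda>s. if rank D2 s > bot then ?t s else 1"
  note ne = Tupl_nonempty[of D S, OF assms(1)]
  show "(INF s \<in> Tupl D S. ?t s) = inf (rank D3 r) (rank ?G r)"
  proof (cases "rank D3 r = bot")
    case True
    then show ?thesis using ne by simp
  next
    case False
    then have pos: "bot < rank D3 r" by (metis not_bot_less)
    have parts: "(r ++ s) |` R = r" "(r ++ s) |` S = s" if "s \<in> Tupl D S" for s
      using that r' assms(2)
      by (simp_all add: restrict_map_add_left restrict_map_add_right restrict_Tupl_self)
    have "rank ?G r = (INF s \<in> Tupl D S. (if bot < rank D2 s then 1 else bot) \<rightarrow>\<^sub>L
        rank D3 r * (if bot < rank D2 s then 1 else bot) * (rank D2 s \<rightarrow>\<^sub>L rank D1 (r ++ s)))"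
      using r' pos by (simp add: gsdo_divide_def rnabla_def rresid_def rjoin_def parts)
    also have "\<dots> = (INF s \<in> Tupl D S. ?u s)"
      by (intro INF_cong refl) simp
    finally have G: "rank ?G r = (INF s \<in> Tupl D S. ?u s)" .
    \<comment> \<open>On the support the term is a product with \<open>rank D3 r\<close> and so
      already below it; off the support the residuum is \<open>1\<close> and the term is
      \<open>rank D3 r\<close> itself.\<close>
    have "?t s = inf (rank D3 r) (?u s)" for s
      by (auto simp: inf_absorb1 inf_absorb2 mult_le_left)
    then have "(INF s \<in> Tupl D S. ?t s) = (INF s \<in> Tupl D S. inf (rank D3 r) (?u s))"
      by (rule INF_cong[OF refl])
    also have "\<dots> = inf (rank D3 r) (INF s \<in> Tupl D S. ?u s)"
      by (rule INF_inf_const1[OF ne])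
    finally show ?thesis unfolding G .
  qed
qed simp

text \<open>The infimum depends on a tuple only through its \<open>R\<close>-part, so it can be
  computed on \<open>R\<close> with a crisp dividend; the join brings back the \<open>T\<close>-part
  together with the factor from \<open>D1\<close>.\<close>

lemma gsd_eq_gsdo:
  assumes "R \<inter> S = {}" and [simp]: "scheme D1 = R \<union> T"
  shows "gsd_divide D R S T D1 D2 D3 =
    rjoin D D1 (gsdo_divide D R S (rnabla D (rproj D R D1)) (rproj D S D2) (rproj D (R \<union> S) D3))"
  unfolding gsd_divide_def rjoin_def
proof (intro mk_rdt_cong)
  let ?G = "gsdo_divide D R S (rnabla D (rproj D R D1)) (rproj D S D2) (rproj D (R \<union> S) D3)"
  have [simp]: "scheme ?G = R" by (simp add: gsdo_divide_def)
  show "R \<union> T = scheme D1 \<union> scheme ?G" by auto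
  fix x assume "x \<in> Tupl D (scheme D1 \<union> scheme ?G)"
  then have x: "x \<in> Tupl D (R \<union> T)" by (simp add: Un_absorb2 Un_commute)
  have self: "x |` (R \<union> T) = x" by (rule restrict_Tupl_self[OF x order_refl])
  show "rank D1 x * (INF s \<in> Tupl D S.
      rank (rproj D S D2) s \<rightarrow>\<^sub>L rank (rproj D (R \<union> S) D3) (x |` R ++ s)) =
    rank D1 (x |` scheme D1) * rank ?G (x |` scheme ?G)"
  proof (cases "rank D1 x = bot")
    case True
    then show ?thesis by (simp add: self)
  next
    case False
    \<comment> \<open>Ensures that the crisp dividend has rank \<open>1\<close> at the
      \<open>R\<close>-part whenever \<open>D1\<close> is nonzero at \<open>x\<close>.\<close>
    have "rank D1 x \<le> rank (rproj D R D1) (x |` R)"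
      using x by (intro rank_le_rproj) auto
    with False have "bot < rank (rproj D R D1) (x |` R)"
      by (metis bot.extremum_uniqueI not_bot_less)
    then show ?thesis
      using x self by (simp add: gsdo_divide_def rnabla_def)
  qed
qed

text \<open>A divisor tuple joinable with \<open>x\<close> is determined by its part on the new
  attributes \<open>S\<close>, and the inner supremum is a value of the projection \<open>P\<close>.
  The crisp tables \<open>N\<close> and \<open>X\<close> mark the relevant \<open>x\<close> and
  \<open>s\<close>. Joining them to the arguments of the residuum brings all three to one scheme
  without altering the terms that count.\<close>

lemma gddo_eq_gsdo:
  fixes D :: "'y \<Rightarrow> 'v set"
    and D1 D2 D3 D4 :: "('y, 'v, 'l::complete_residuated_lattice) rdt"
  assumes sch [simp]: "scheme D1 = R1" "scheme D2 = R2" "scheme D3 = R3" "scheme D4 = R4"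
  defines "N \<equiv> rjoin D (rnabla D D1) (rnabla D D2)"
    and "S \<equiv> R4 - (R1 \<union> R2)"
  defines "X \<equiv> rnabla D (rproj D S D4)"
    and "P \<equiv> rproj D (R3 \<inter> (R1 \<union> R4)) D3"
  shows "gddo_divide D R1 R2 R3 R4 D1 D2 D3 D4 =
    rjoin D (rjoin D D1 D2) (gsdo_divide D (R1 \<union> R2) S N X
      (rresid D (rjoin D N X) (rjoin D N D4) (rjoin D (rjoin D N X) P)))"
  unfolding gddo_divide_def rjoin_def[of D "rjoin D D1 D2"]
proof (intro mk_rdt_cong)
  let ?Y = "rresid D (rjoin D N X) (rjoin D N D4) (rjoin D (rjoin D N X) P)"
  let ?G = "gsdo_divide D (R1 \<union> R2) S N X ?Y"
  have [simp]: "scheme ?G = R1 \<union> R2" by (simp add: gsdo_divide_def)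
  have [simp]: "scheme N = R1 \<union> R2" "scheme X = S" "scheme P = R3 \<inter> (R1 \<union> R4)"
    by (simp_all add: N_def X_def P_def)
  show "R1 \<union> R2 = scheme (rjoin D D1 D2) \<union> scheme ?G" by simp
  fix x assume "x \<in> Tupl D (scheme (rjoin D D1 D2) \<union> scheme ?G)"
  then have x: "x \<in> Tupl D (R1 \<union> R2)" by simp
  have self: "x |` (R1 \<union> R2) = x" by (rule restrict_Tupl_self[OF x order_refl])
  have disj: "(R1 \<union> R2) \<inter> S = {}" and S_sub: "S \<subseteq> R4" by (auto simp: S_def)
  have rank12: "rank (rjoin D D1 D2) x = rank D1 (x |` R1) * rank D2 (x |` R2)"
    using x by (simp add: rjoin_def)
  let ?sup = "\<lambda>r4. SUP r3 \<in> {r3 \<in> Tupl D R3. joinable (x |` R1 ++ r4) r3}. rank D3 r3"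
  let ?I = "INF r4 \<in> {r4 \<in> Tupl D R4. joinable x r4}. rank D4 r4 \<rightarrow>\<^sub>L ?sup r4"
  have "rank ?G x = ?I" if pos: "bot < rank D1 (x |` R1)" "bot < rank D2 (x |` R2)"
  proof -
    have Nx: "rank N x = 1"
      using x pos by (simp add: N_def rjoin_def rnabla_def)
    \<comment> \<open>Reindexes the infimum by \<open>Tupl D S\<close>: outside \<open>S\<close> the
      values of \<open>r4\<close> are those of \<open>x\<close>.\<close>
    have im: "{r4 \<in> Tupl D R4. joinable x r4} = (\<lambda>s. (x ++ s) |` R4) ` Tupl D S"
    proof (intro equalityI subsetI)
      fix r4 assume "r4 \<in> {r4 \<in> Tupl D R4. joinable x r4}"
      then have r4: "r4 \<in> Tupl D R4" "joinable x r4" by auto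
      note d = dom_Tupl[OF x] dom_Tupl[OF r4(1)]
      from r4 have "r4 |` S \<in> Tupl D S" using S_sub by auto
      moreover have "r4 = (x ++ r4 |` S) |` R4"
      proof
        fix y
        consider "y \<notin> R4" | "y \<in> S" | "y \<in> R4" "y \<in> R1 \<union> R2" by (auto simp: S_def)
        then show "r4 y = ((x ++ r4 |` S) |` R4) y"
        proof cases
          case 1 then show ?thesis using d by auto
        next
          case 2
          then obtain v where "r4 y = Some v" "y \<in> R4" using d S_sub by blast
          then show ?thesis using 2 by (simp add: map_add_def)
        next
          case 3
          then have "y \<notin> S" using disj by blast
          moreover have "x y = r4 y" using 3 d r4(2) unfolding joinable_iff by blast
          ultimately show ?thesis using 3 by (simp add: map_add_def)
        qed
      qed
      ultimately show "r4 \<in> (\<lambda>s. (x ++ s) |` R4) ` Tupl D S" by blast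
    next
      fix r4 assume "r4 \<in> (\<lambda>s. (x ++ s) |` R4) ` Tupl D S"
      then obtain s where s: "s \<in> Tupl D S" "r4 = (x ++ s) |` R4" by blast
      have "(x ++ s) |` R4 \<in> Tupl D R4"
        using map_add_in_Tupl[OF x s(1)] by (rule restrict_in_Tupl) (auto simp: S_def)
      moreover have "joinable x ((x ++ s) |` R4)"
      proof -
        have "s y = None" if "y \<in> R1 \<union> R2" for y
          using that disj dom_Tupl[OF s(1)] by blast
        then show ?thesis
          using dom_Tupl[OF x] by (auto simp: joinable_iff map_add_def split: option.splits)
      qed
      ultimately show "r4 \<in> {r4 \<in> Tupl D R4. joinable x r4}" using s by simp
    qed
    have term_eq: "rank X s \<rightarrow>\<^sub>L rank ?Y (x ++ s) =
        rank D4 ((x ++ s) |` R4) \<rightarrow>\<^sub>L ?sup ((x ++ s) |` R4)"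
      if s: "s \<in> Tupl D S" for s
    proof -
      let ?z = "x ++ s"
      have z: "?z \<in> Tupl D (R1 \<union> R2 \<union> S)" using x s by (rule map_add_in_Tupl)
      have zx: "?z |` (R1 \<union> R2) = x" and zs: "?z |` S = s"
        using restrict_map_add_left[OF x s disj] restrict_map_add_right[OF s order_refl, of x]
          self restrict_Tupl_self[OF s order_refl] by simp_all
      have z4: "?z |` R4 \<in> Tupl D R4" using z by (rule restrict_in_Tupl) (auto simp: S_def)
      have zNX: "?z |` (R1 \<union> R2 \<union> S) = ?z" by (rule restrict_Tupl_self[OF z order_refl])
      \<comment> \<open>The attributes of \<open>R4\<close> outside \<open>R1\<close> and
        \<open>R2\<close> are exactly \<open>S\<close>, so all arguments of the residuum share the
        scheme of \<open>rjoin D N X\<close>.\<close>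
      have sch_eq: "R1 \<union> R2 \<union> R4 = R1 \<union> R2 \<union> S"
        "R1 \<union> R2 \<union> S \<union> R3 \<inter> (R1 \<union> R4) = R1 \<union> R2 \<union> S" by (auto simp: S_def)
      have rNX: "rank (rjoin D N X) ?z = rank X s"
        using z by (simp add: rjoin_def[of D N X] zx zs Nx)
      have rN4: "rank (rjoin D N D4) ?z = rank D4 (?z |` R4)"
        using z by (simp add: rjoin_def[of D N D4] sch_eq zx Nx)
      have rNXP: "rank (rjoin D (rjoin D N X) P) ?z = rank X s * rank P (?z |` (R3 \<inter> (R1 \<union> R4)))"
        using z by (simp add: rjoin_def[of D "rjoin D N X"] sch_eq zNX rNX)
      have rY: "rank ?Y ?z = rank X s *
          (rank D4 (?z |` R4) \<rightarrow>\<^sub>L rank X s * rank P (?z |` (R3 \<inter> (R1 \<union> R4))))"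
        using z by (simp add: rresid_def rNX rN4 rNXP)
      have w: "x |` R1 ++ ?z |` R4 = ?z |` (R1 \<union> R4)"
      proof
        fix y
        have "s y = None" if "y \<in> R1"
          using that disj dom_Tupl[OF s] by blast
        then show "(x |` R1 ++ ?z |` R4) y = (?z |` (R1 \<union> R4)) y"
          by (auto simp: map_add_def restrict_map_def split: option.splits)
      qed
      \<comment> \<open>Joinability is agreement on the common attributes, which is membership in a
        fibre of the projection \<open>P\<close>; so the supremum is a rank of
        \<open>P\<close>.\<close>
      have "joinable (?z |` (R1 \<union> R4)) r3 \<longleftrightarrow>
          r3 |` (R3 \<inter> (R1 \<union> R4)) = ?z |` (R3 \<inter> (R1 \<union> R4))" if "r3 \<in> Tupl D R3" for r3
      proof -
        have "dom ?z = R1 \<union> R2 \<union> S" "dom r3 = R3" using z that by (auto simp only: dom_Tupl)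
        then have "dom (?z |` (R1 \<union> R4)) \<inter> dom r3 = R3 \<inter> (R1 \<union> R4)"
          unfolding dom_restrict by (auto simp: S_def)
        moreover have "(R1 \<union> R4) \<inter> (R3 \<inter> (R1 \<union> R4)) = R3 \<inter> (R1 \<union> R4)" by blast
        ultimately show ?thesis unfolding joinable_def restrict_restrict by auto
      qed
      moreover have "?z |` (R3 \<inter> (R1 \<union> R4)) \<in> Tupl D (R3 \<inter> (R1 \<union> R4))"
        using z by (rule restrict_in_Tupl) (auto simp: S_def)
      ultimately have sup: "?sup (?z |` R4) = rank P (?z |` (R3 \<inter> (R1 \<union> R4)))"
        unfolding P_def rproj_def w by (auto intro!: SUP_cong)
      show ?thesis
      proof (cases "bot < rank (rproj D S D4) s")
        case True
        then have "rank X s = 1" using s by (simp add: X_def rnabla_def)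
        then show ?thesis by (simp add: rY sup)
      next
        \<comment> \<open>Here \<open>s\<close> extends to no tuple in the support of
          \<open>D4\<close>, so both residua have antecedent \<open>bot\<close> and equal
          \<open>1\<close>.\<close>
        case False
        then have "rank X s = bot" using s by (simp add: X_def rnabla_def)
        moreover have "rank D4 (?z |` R4) \<le> rank (rproj D S D4) (?z |` R4 |` S)"
          using z4 S_sub by (intro rank_le_rproj) auto
        then have "rank D4 (?z |` R4) = bot"
          using False zs S_sub by (simp add: Int_absorb1 bot.extremum_unique)
        ultimately show ?thesis by simp
      qed
    qed
    have "rank ?G x = (INF s \<in> Tupl D S. rank X s \<rightarrow>\<^sub>L rank ?Y (x ++ s))"
      using x Nx by (simp add: gsdo_divide_def)
    also have "\<dots> = ?I"
      unfolding im image_image by (intro INF_cong refl term_eq)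
    finally show ?thesis .
  qed
  \<comment> \<open>If one of the dividends vanishes, the outer product is \<open>bot\<close> on
    both sides, so the value of the division is irrelevant there.\<close>
  then show "rank D1 (x |` R1) * rank D2 (x |` R2) * ?I =
      rank (rjoin D D1 D2) (x |` scheme (rjoin D D1 D2)) * rank ?G (x |` scheme ?G)"
    by (cases "bot < rank D1 (x |` R1) \<and> bot < rank D2 (x |` R2)")
      (auto simp: self rank12)
qed


section \<open>Definable operations\<close>

text \<open>Definability of a semantic map \<open>F\<close>, with one expression for all tables.
  This lets expressions be composed without being written out; the recorded scheme of
  \<open>F Ts\<close> discharges the scheme hypotheses of the identities above.\<close>

definition definable ::
    "('y \<Rightarrow> 'v set) \<Rightarrow> division \<Rightarrow> 'y set list \<Rightarrow> 'y set \<Rightarrow>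
      (('y, 'v, 'l::complete_residuated_lattice) rdt list \<Rightarrow> ('y, 'v, 'l) rdt) \<Rightarrow> bool" where
  "definable D B Rs R F \<longleftrightarrow> (\<exists>e. expr_on Rs e R \<and> divisions e \<subseteq> {B} \<and>
     (\<forall>Ts. list_all2 (is_rdt D) Rs Ts \<longrightarrow> scheme (F Ts) = R \<and> eval D Ts e = F Ts))"

section \<open>Closure of definability under the base operations and under the division
  \<open>B\<close>\<close>

lemma definable_cong:
  assumes "definable D B Rs R F"
    and "\<And>Ts. list_all2 (is_rdt D) Rs Ts \<Longrightarrow> G Ts = F Ts"
  shows "definable D B Rs R G"
  using assms unfolding definable_def by metis

lemma definable_scheme:
  "definable D B Rs R F \<Longrightarrow> list_all2 (is_rdt D) Rs Ts \<Longrightarrow> scheme (F Ts) = R"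
  unfolding definable_def by blast

lemma definable_Sym:
  assumes "i < length Rs" "Rs ! i = R"
  shows "definable D B Rs R (\<lambda>Ts. Ts ! i)"
  unfolding definable_def
  using assms by (intro exI[of _ "Sym i"])
    (auto intro: expr_on.intros simp: is_rdt_def list_all2_conv_all_nth)

lemma definable_One: "definable D B Rs {} (\<lambda>Ts. rone D)"
  unfolding definable_def by (intro exI[of _ One]) (auto intro: expr_on.intros)

lemma definable_Intersect:
  assumes "definable D B Rs R F" "definable D B Rs R G"
  shows "definable D B Rs R (\<lambda>Ts. rinter D (F Ts) (G Ts))"
proof -
  obtain e f where "expr_on Rs e R" "divisions e \<subseteq> {B}" "expr_on Rs f R" "divisions f \<subseteq> {B}"
    "\<forall>Ts. list_all2 (is_rdt D) Rs Ts \<longrightarrow> scheme (F Ts) = R \<and> eval D Ts e = F Ts"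
    "\<forall>Ts. list_all2 (is_rdt D) Rs Ts \<longrightarrow> scheme (G Ts) = R \<and> eval D Ts f = G Ts"
    using assms unfolding definable_def by blast
  then show ?thesis
    unfolding definable_def by (intro exI[of _ "Intersect e f"]) (auto intro: expr_on.intros)
qed

lemma definable_Join:
  assumes "definable D B Rs R F" "definable D B Rs S G" "Q = R \<union> S"
  shows "definable D B Rs Q (\<lambda>Ts. rjoin D (F Ts) (G Ts))"
proof -
  obtain e f where "expr_on Rs e R" "divisions e \<subseteq> {B}" "expr_on Rs f S" "divisions f \<subseteq> {B}"
    "\<forall>Ts. list_all2 (is_rdt D) Rs Ts \<longrightarrow> scheme (F Ts) = R \<and> eval D Ts e = F Ts"
    "\<forall>Ts. list_all2 (is_rdt D) Rs Ts \<longrightarrow> scheme (G Ts) = S \<and> eval D Ts f = G Ts"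
    using assms unfolding definable_def by blast
  then show ?thesis
    unfolding definable_def assms(3)
    by (intro exI[of _ "Join e f"]) (auto intro: expr_on.intros)
qed

lemma definable_Proj:
  assumes "definable D B Rs R F" "S \<subseteq> R"
  shows "definable D B Rs S (\<lambda>Ts. rproj D S (F Ts))"
proof -
  obtain e where "expr_on Rs e R" "divisions e \<subseteq> {B}"
    "\<forall>Ts. list_all2 (is_rdt D) Rs Ts \<longrightarrow> scheme (F Ts) = R \<and> eval D Ts e = F Ts"
    using assms unfolding definable_def by blast
  then show ?thesis
    unfolding definable_def using assms(2)
    by (intro exI[of _ "Proj S e"]) (auto intro: expr_on.intros)
qed

lemma definable_Nabla:
  assumes "definable D B Rs R F"
  shows "definable D B Rs R (\<lambda>Ts. rnabla D (F Ts))"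
proof -
  obtain e where "expr_on Rs e R" "divisions e \<subseteq> {B}"
    "\<forall>Ts. list_all2 (is_rdt D) Rs Ts \<longrightarrow> scheme (F Ts) = R \<and> eval D Ts e = F Ts"
    using assms unfolding definable_def by blast
  then show ?thesis
    unfolding definable_def by (intro exI[of _ "Nabla e"]) (auto intro: expr_on.intros)
qed

lemma definable_Resid:
  assumes "definable D B Rs R H" "definable D B Rs R F" "definable D B Rs R G"
  shows "definable D B Rs R (\<lambda>Ts. rresid D (H Ts) (F Ts) (G Ts))"
proof -
  obtain h where h: "expr_on Rs h R" "divisions h \<subseteq> {B}"
    "\<forall>Ts. list_all2 (is_rdt D) Rs Ts \<longrightarrow> scheme (H Ts) = R \<and> eval D Ts h = H Ts"
    using assms(1) unfolding definable_def by blast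
  obtain e where e: "expr_on Rs e R" "divisions e \<subseteq> {B}"
    "\<forall>Ts. list_all2 (is_rdt D) Rs Ts \<longrightarrow> scheme (F Ts) = R \<and> eval D Ts e = F Ts"
    using assms(2) unfolding definable_def by blast
  obtain f where f: "expr_on Rs f R" "divisions f \<subseteq> {B}"
    "\<forall>Ts. list_all2 (is_rdt D) Rs Ts \<longrightarrow> scheme (G Ts) = R \<and> eval D Ts f = G Ts"
    using assms(3) unfolding definable_def by blast
  have "expr_on Rs (Resid h e f) R" using h(1) e(1) f(1) by (rule expr_on.intros)
  then show ?thesis
    unfolding definable_def using h e f by (intro exI[of _ "Resid h e f"]) simp
qed

text \<open>Collects the expressions for the separate arguments into one list that works for all
  tables, as the constructor \<open>Divide\<close> requires.\<close>

lemma definable_list: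
  fixes Fs :: "(('y, 'v, 'l::complete_residuated_lattice) rdt list \<Rightarrow> ('y, 'v, 'l) rdt) list"
  assumes "list_all2 (definable D B Rs) Qs Fs"
  shows "\<exists>es. list_all2 (expr_on Rs) es Qs \<and> (\<forall>e \<in> set es. divisions e \<subseteq> {B}) \<and>
    (\<forall>Ts. list_all2 (is_rdt D) Rs Ts \<longrightarrow> map (eval D Ts) es = map (\<lambda>F. F Ts) Fs)"
  using assms
proof (induction rule: list_all2_induct)
  case Nil
  show ?case by (intro exI[of _ "[]"]) simp
next
  case (Cons Q Qs F Fs)
  obtain e where e: "expr_on Rs e Q" "divisions e \<subseteq> {B}"
    "\<forall>Ts. list_all2 (is_rdt D) Rs Ts \<longrightarrow> scheme (F Ts) = Q \<and> eval D Ts e = F Ts"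
    using Cons.hyps(1) unfolding definable_def by blast
  obtain es where es: "list_all2 (expr_on Rs) es Qs" "\<forall>e \<in> set es. divisions e \<subseteq> {B}"
    "\<forall>Ts. list_all2 (is_rdt D) Rs Ts \<longrightarrow> map (eval D Ts) es = map (\<lambda>F. F Ts) Fs"
    using Cons.IH by blast
  show ?case
  proof (intro exI[of _ "e # es"] conjI allI impI)
    fix Ts :: "('y, 'v, 'l) rdt list" assume "list_all2 (is_rdt D) Rs Ts"
    with e(3) es(3) show "map (eval D Ts) (e # es) = map (\<lambda>F. F Ts) (F # Fs)"
      by (simp only: list.map)
  qed (use e es in auto)
qed

lemma definable_Divide:
  fixes Fs :: "(('y, 'v, 'l::complete_residuated_lattice) rdt list \<Rightarrow> ('y, 'v, 'l) rdt) list"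
  assumes "admissible b" "kind b = B" "list_all2 (definable D B Rs) (arg_schemes b) Fs"
  shows "definable D B Rs (res_scheme b) (\<lambda>Ts. div_apply D b (map (\<lambda>F. F Ts) Fs))"
proof -
  obtain es where es: "list_all2 (expr_on Rs) es (arg_schemes b)"
    "\<forall>e \<in> set es. divisions e \<subseteq> {B}"
    "\<forall>Ts. list_all2 (is_rdt D) Rs Ts \<longrightarrow> map (eval D Ts) es = map (\<lambda>F. F Ts) Fs"
    using definable_list[OF assms(3)] by blast
  have len: "length Fs = length (arg_schemes b)"
    using assms(3) by (simp add: list_all2_lengthD)
  show ?thesis
    unfolding definable_def
  proof (intro exI[of _ "Divide b es"] conjI allI impI)
    show "expr_on Rs (Divide b es) (res_scheme b)"
      using assms(1) es(1) by (rule expr_on.intros)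
    show "divisions (Divide b es) \<subseteq> {B}" using es(2) assms(2) by auto
  next
    fix Ts :: "('y, 'v, 'l) rdt list" assume "list_all2 (is_rdt D) Rs Ts"
    then have "map (eval D Ts) es = map (\<lambda>F. F Ts) Fs" using es(3) by blast
    then show "eval D Ts (Divide b es) = div_apply D b (map (\<lambda>F. F Ts) Fs)"
      by (simp only: eval.simps)
  qed (simp add: len)
qed

text \<open>The hub of the reduction: whichever division \<open>B\<close> is permitted, the original
  Small Divide is available, by the identity belonging to \<open>B\<close>. After this no other
  lemma needs to distinguish the cases of \<open>B\<close>.\<close>

lemma definable_gsdo:
  assumes "\<And>y. D y \<noteq> {}" and RS: "R \<inter> S = {}" "finite R" "finite S"
    and F: "definable D B Rs R F" and G: "definable D B Rs S G"
    and H: "definable D B Rs (R \<union> S) H"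
  shows "definable D B Rs R (\<lambda>Ts. gsdo_divide D R S (F Ts) (G Ts) (H Ts))"
proof (cases B)
  case Div
  then have kind: "kind (DivOp R S) = B" by simp
  have "definable D B Rs R (\<lambda>Ts. range_divide D R S (H Ts) (G Ts) (rnabla D (F Ts)))"
    using definable_Divide[OF _ kind, of D Rs "[H, G, \<lambda>Ts. rnabla D (F Ts)]"] RS
    by (simp add: admissible_def F G H definable_Nabla)
  then have "definable D B Rs R
      (\<lambda>Ts. rjoin D (F Ts) (range_divide D R S (H Ts) (G Ts) (rnabla D (F Ts))))"
    by (intro definable_Join[OF F]) auto
  then show ?thesis
    by (rule definable_cong) (intro gsdo_eq_range definable_scheme[OF F])
next
  case Gsdo
  then have kind: "kind (GsdoOp R S) = B" by simp
  show ?thesis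
    using definable_Divide[OF _ kind, of D Rs "[F, G, H]"] RS
    by (simp add: admissible_def F G H)
next
  case Gsd
  then have kind: "kind (GsdOp R S {} {} {}) = B" by simp
  have "definable D B Rs R (\<lambda>Ts. gsd_divide D R S {} (F Ts) (G Ts) (H Ts))"
    using definable_Divide[OF _ kind, of D Rs "[F, G, H]"] RS
    by (simp add: admissible_def F G H)
  then show ?thesis
    by (rule definable_cong)
      (simp add: gsdo_eq_gsd definable_scheme[OF F] definable_scheme[OF G] definable_scheme[OF H])
next
  case Ggdo
  then have kind: "kind (GgdoOp R S {}) = B" by simp
  have "definable D B Rs R (\<lambda>Ts. ggdo_divide D R S {} (F Ts) (rone D) (H Ts) (G Ts))"
    using definable_Divide[OF _ kind, of D Rs "[F, \<lambda>Ts. rone D, H, G]"] RS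
    by (simp add: admissible_def F G H definable_One)
  then show ?thesis
    by (rule definable_cong) (rule gsdo_eq_ggdo)
next
  case Gddo
  \<comment> \<open>Two identities are chained here: \<open>gsdo\<close> as a Great Divide with
    empty \<open>T\<close>, then that Great Divide as a Darwen's Divide.\<close>
  then have kind: "kind (GddoOp R {} (R \<union> S) S) = B" by simp
  have "definable D B Rs R
      (\<lambda>Ts. gddo_divide D R {} (R \<union> S) S (F Ts) (rone D) (H Ts) (G Ts))"
    using definable_Divide[OF _ kind, of D Rs "[F, \<lambda>Ts. rone D, H, G]"] RS
    by (simp add: admissible_def F G H definable_One)
  then show ?thesis
    by (rule definable_cong) (use RS in \<open>simp add: gsdo_eq_ggdo ggdo_eq_gddo\<close>)
qed

text \<open>Follows \<open>gddo_eq_gsdo\<close>, with its auxiliary tables turned into functions of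
  the arguments so that each is shown definable separately.\<close>

lemma definable_gddo:
  assumes "\<And>y. D y \<noteq> {}" and fin: "finite R1" "finite R2" "finite R4"
    and F: "definable D B Rs R1 F1" "definable D B Rs R2 F2"
      "definable D B Rs R3 F3" "definable D B Rs R4 F4"
  shows "definable D B Rs (R1 \<union> R2)
    (\<lambda>Ts. gddo_divide D R1 R2 R3 R4 (F1 Ts) (F2 Ts) (F3 Ts) (F4 Ts))"
proof -
  define S where "S = R4 - (R1 \<union> R2)"
  define N where "N Ts = rjoin D (rnabla D (F1 Ts)) (rnabla D (F2 Ts))" for Ts
  define X where "X Ts = rnabla D (rproj D S (F4 Ts))" for Ts
  define P where "P Ts = rproj D (R3 \<inter> (R1 \<union> R4)) (F3 Ts)" for Ts
  have N: "definable D B Rs (R1 \<union> R2) N"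
    unfolding N_def by (rule definable_Join definable_Nabla F refl)+
  have X: "definable D B Rs S X"
    unfolding X_def by (intro definable_Nabla definable_Proj[OF F(4)]) (auto simp: S_def)
  have P: "definable D B Rs (R3 \<inter> (R1 \<union> R4)) P"
    unfolding P_def by (intro definable_Proj[OF F(3)]) auto
  have NX: "definable D B Rs (R1 \<union> R2 \<union> S) (\<lambda>Ts. rjoin D (N Ts) (X Ts))"
    by (intro definable_Join[OF N X] refl)
  have "definable D B Rs (R1 \<union> R2 \<union> S) (\<lambda>Ts. rresid D (rjoin D (N Ts) (X Ts))
      (rjoin D (N Ts) (F4 Ts)) (rjoin D (rjoin D (N Ts) (X Ts)) (P Ts)))"
    by (intro definable_Resid NX definable_Join[OF N F(4)] definable_Join[OF NX P])
      (auto simp: S_def)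
  then have "definable D B Rs (R1 \<union> R2) (\<lambda>Ts. gsdo_divide D (R1 \<union> R2) S (N Ts) (X Ts)
      (rresid D (rjoin D (N Ts) (X Ts)) (rjoin D (N Ts) (F4 Ts))
        (rjoin D (rjoin D (N Ts) (X Ts)) (P Ts))))"
    using assms(1) fin by (intro definable_gsdo N X) (auto simp: S_def)
  then have "definable D B Rs (R1 \<union> R2) (\<lambda>Ts. rjoin D (rjoin D (F1 Ts) (F2 Ts))
      (gsdo_divide D (R1 \<union> R2) S (N Ts) (X Ts) (rresid D (rjoin D (N Ts) (X Ts))
        (rjoin D (N Ts) (F4 Ts)) (rjoin D (rjoin D (N Ts) (X Ts)) (P Ts)))))"
    by (intro definable_Join[OF definable_Join[OF F(1,2) refl]]) auto
  then show ?thesis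
    unfolding N_def X_def P_def S_def
    by (rule definable_cong) (intro gddo_eq_gsdo F[THEN definable_scheme])
qed

lemma definable_division:
  fixes D :: "'y \<Rightarrow> 'v set" and a :: "'y divop"
  assumes D: "\<And>y. D y \<noteq> {}" and "admissible a"
  shows "definable D B (arg_schemes a) (res_scheme a)
    (div_apply D a :: ('y, 'v, 'l::complete_residuated_lattice) rdt list \<Rightarrow> _)"
proof (cases a)
  case (DivOp R S)
  let ?Rs = "[R \<union> S, S, R]"
  have RS: "R \<inter> S = {}" "finite R" "finite S"
    using assms(2) DivOp by (auto simp: admissible_def)
  have T: "definable D B ?Rs (R \<union> S) (\<lambda>Ts. Ts ! 0)" "definable D B ?Rs S (\<lambda>Ts. Ts ! 1)"
    "definable D B ?Rs R (\<lambda>Ts. Ts ! 2)"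
    by (auto intro: definable_Sym)
  have "definable D B ?Rs R (\<lambda>Ts. rinter D (Ts ! 2)
      (gsdo_divide D R S (rnabla D (Ts ! 2)) (rnabla D (Ts ! 1))
        (rresid D (rjoin D (Ts ! 2) (rnabla D (Ts ! 1))) (rjoin D (rnabla D (Ts ! 2)) (Ts ! 1))
          (Ts ! 0))))"
    by (rule T definable_Intersect definable_gsdo D RS definable_Resid definable_Nabla
        definable_Join | blast)+
  then show ?thesis
    unfolding DivOp arg_schemes.simps res_scheme.simps
    by (rule definable_cong)
      (use RS(1) in \<open>auto simp: list_all2_Cons1 is_rdt_def intro!: range_eq_gsdo D\<close>)
next
  case (GsdoOp R S)
  let ?Rs = "[R, S, R \<union> S]"
  have RS: "R \<inter> S = {}" "finite R" "finite S"
    using assms(2) GsdoOp by (auto simp: admissible_def)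
  have "definable D B ?Rs R (\<lambda>Ts. gsdo_divide D R S (Ts ! 0) (Ts ! 1) (Ts ! 2))"
    by (intro definable_gsdo definable_Sym D RS) auto
  then show ?thesis
    unfolding GsdoOp arg_schemes.simps res_scheme.simps
    by (rule definable_cong) (auto simp: list_all2_Cons1)
next
  case (GsdOp R S T U V)
  let ?Rs = "[R \<union> T, S \<union> U, R \<union> S \<union> V]"
  have RS: "R \<inter> S = {}" "finite R" "finite S"
    using assms(2) GsdOp by (auto simp: admissible_def)
  have T: "definable D B ?Rs (R \<union> T) (\<lambda>Ts. Ts ! 0)" "definable D B ?Rs (S \<union> U) (\<lambda>Ts. Ts ! 1)"
    "definable D B ?Rs (R \<union> S \<union> V) (\<lambda>Ts. Ts ! 2)"
    by (auto intro: definable_Sym)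
  have "definable D B ?Rs R (\<lambda>Ts. gsdo_divide D R S (rnabla D (rproj D R (Ts ! 0)))
      (rproj D S (Ts ! 1)) (rproj D (R \<union> S) (Ts ! 2)))"
    by (intro definable_gsdo definable_Nabla T[THEN definable_Proj] D RS) auto
  then have "definable D B ?Rs (R \<union> T) (\<lambda>Ts. rjoin D (Ts ! 0)
      (gsdo_divide D R S (rnabla D (rproj D R (Ts ! 0)))
        (rproj D S (Ts ! 1)) (rproj D (R \<union> S) (Ts ! 2))))"
    by (intro definable_Join[OF T(1)]) auto
  then show ?thesis
    unfolding GsdOp arg_schemes.simps res_scheme.simps
    by (rule definable_cong)
      (use RS(1) in \<open>auto simp: list_all2_Cons1 is_rdt_def intro!: gsd_eq_gsdo\<close>)
next
  case (GgdoOp R S T)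
  let ?Rs = "[R, T, R \<union> S, S \<union> T]"
  have RST: "R \<inter> S = {}" "S \<inter> T = {}" "R \<inter> T = {}" "finite R" "finite T" "finite (S \<union> T)"
    using assms(2) GgdoOp by (auto simp: admissible_def)
  \<comment> \<open>The Great Divide needs no reduction of its own, being Darwen's Divide on the
    block schemes.\<close>
  have "definable D B ?Rs (R \<union> T)
      (\<lambda>Ts. gddo_divide D R T (R \<union> S) (S \<union> T) (Ts ! 0) (Ts ! 1) (Ts ! 2) (Ts ! 3))"
    by (intro definable_gddo definable_Sym D RST) auto
  then show ?thesis
    unfolding GgdoOp arg_schemes.simps res_scheme.simps
    by (rule definable_cong) (auto simp: list_all2_Cons1 ggdo_eq_gddo RST)
next
  case (GddoOp R1 R2 R3 R4)
  let ?Rs = "[R1, R2, R3, R4]"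
  have fin: "finite R1" "finite R2" "finite R4"
    using assms(2) GddoOp by (auto simp: admissible_def)
  have "definable D B ?Rs (R1 \<union> R2)
      (\<lambda>Ts. gddo_divide D R1 R2 R3 R4 (Ts ! 0) (Ts ! 1) (Ts ! 2) (Ts ! 3))"
    by (intro definable_gddo definable_Sym D fin) auto
  then show ?thesis
    unfolding GddoOp arg_schemes.simps res_scheme.simps
    by (rule definable_cong) (auto simp: list_all2_Cons1)
qed

theorem corollary13:
  fixes D :: "'y \<Rightarrow> 'v set"
    and A B :: division
    and a :: "'y divop"
  assumes "\<And>y. D y \<noteq> {}"
    and "kind a = A"
    and "admissible a"
  shows "\<exists>e. expr_on (arg_schemes a) e (res_scheme a) \<and> divisions e \<subseteq> {B} \<and>
    (\<forall>Ts :: ('y, 'v, 'l::complete_residuated_lattice) rdt list.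
       list_all2 (is_rdt D) (arg_schemes a) Ts \<longrightarrow> eval D Ts e = div_apply D a Ts)"
proof -
  have "definable D B (arg_schemes a) (res_scheme a)
      (div_apply D a :: ('y, 'v, 'l) rdt list \<Rightarrow> _)"
    using assms(1,3) by (rule definable_division)
  then show ?thesis unfolding definable_def by blast
qed

end
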